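(* 1) Let $\mathcal A=\langle A;\Xi\rangle$ be an sp-residually finite algebra. A function $f\colon A\to A$ is stable preorder preserving if and only if for every $\mathcal A$-recognizable $L\subseteq A$, $f^{-1}(L)$ is in the lattice $\mathfrak L_{\mathcal A}(L)$. 2) Let $\mathcal A=\langle A;\Xi\rangle$ be a c-residually finite algebra. A function $f\colon A\to A$ is congruence preserving if and only if for every $\mathcal A$-recognizable $L\subseteq A$, $f^{-1}(L)$ is in the Boolean algebra $\mathfrak B_{\mathcal A}(L)$.
   Context: An algebra $\mathcal A=\langle A;\Xi\rangle$ is a nonempty set $A$ with a set $\Xi$ of operations $\xi\colon A^{ar(\xi)}\to A$ of finite arities. A preorder is a reflexive transitive relation. A binary relation $\rho$ on $A$ is compatible with $g\colon A^p\to A$ if $x_1\rho y_1,\dots,x_p\rho y_p$ imply $g(x_1,\dots,x_p)\,\rho\,g(y_1,\dots,y_p)$; it is $\mathcal A$-stable if compatible with every $\xi\in\Xi$. An $\mathcal A$-congruence is an $\mathcal A$-stable equivalence relation. A function $f\colon A\to A$ is stable preorder preserving (resp. congruence preserving) if every $\mathcal A$-stable preorder (resp. every $\mathcal A$-congruence) is compatible with $f$. A congruence has finite index if it has finitely many classes; a stable preorder $\preceq$ has finite index if the congruence $x\sim y\Leftrightarrow(x\preceq y\wedge y\preceq x)$ has finite index. A congruence is c-residually finite if it is the intersection of a family of finite index congruences; a stable preorder is sp-residually finite if it is the intersection of a family of stable preorders all of finite index. The algebra $\mathcal A$ is c-residually finite (resp. sp-residually finite) if all its congruences (resp. all its stable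 preorders) are c-residually finite (resp. sp-residually finite). A subset $L\subseteq A$ is $\mathcal A$-recognizable if there are a finite algebra $\mathcal M$ with the same signature as $\mathcal A$ and a surjective morphism $\varphi\colon\mathcal A\to\mathcal M$ such that $L=\varphi^{-1}(\varphi(L))$. The 1-freezifications of an operation $\xi$ of arity $n$ are $\xi$ itself if $n=1$, and, if $n\ge2$, all unary functions $x\mapsto\xi(c_1,\dots,c_{i-1},x,c_{i+1},\dots,c_n)$ with $1\le i\le n$ and $c_j\in A$. $\mathrm{Frz}^*(\mathcal A)$ is the set of unary functions on $A$ consisting of the identity and all compositions of 1-freezifications of operations in $\Xi$. A (bounded) lattice of subsets of $A$ is a family of subsets containing $A$ and $\emptyset$ and closed under binary unions and intersections; a Boolean algebra of subsets is such a lattice closed under complementation. $\mathfrak L_{\mathcal A}(L)$ (resp. $\mathfrak B_{\mathcal A}(L)$) is the smallest bounded lattice (resp. Boolean algebra) of subsets of $A$ which contains $L$ and is closed under $X\mapsto\gamma^{-1}(X)$ for all $\gamma\in\mathrm{Frz}^*(\mathcal A)$. *)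

theory Defs
  imports Main "HOL-Library.FuncSet"
begin

section \<open>Algebras\<close>

text \<open>
  The operations are a family indexed by operation symbols, so that algebras with different
  carriers can share a signature. An \<open>n\<close>-ary operation takes its arguments as a list of length
  \<open>n\<close> over the carrier; its values on any other list are irrelevant. Nullary operations are
  allowed.
\<close>

record ('a, 'o) algebra =
  carrier :: "'a set"
  symbols :: "'o set"
  arity :: "'o \<Rightarrow> nat"
  interp :: "'o \<Rightarrow> 'a list \<Rightarrow> 'a"

definition tuples :: "'a set \<Rightarrow> nat \<Rightarrow> 'a list set" where
  "tuples A n = {xs. length xs = n \<and> set xs \<subseteq> A}"

definition is_algebra :: "('a, 'o) algebra \<Rightarrow> bool" where
  "is_algebra \<A> \<longleftrightarrow> carrier \<A> \<noteq> {} \<and>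
     (\<forall>\<xi>\<in>symbols \<A>. interp \<A> \<xi> \<in> tuples (carrier \<A>) (arity \<A> \<xi>) \<rightarrow> carrier \<A>)"

section \<open>Stable relations and preserving functions\<close>

text \<open>Relations are sets of pairs; they are used only when contained in \<open>A \<times> A\<close>.\<close>

definition compatible :: "('a \<times> 'a) set \<Rightarrow> nat \<Rightarrow> ('a list \<Rightarrow> 'a) \<Rightarrow> bool" where
  "compatible r p g \<longleftrightarrow>
     (\<forall>xs ys. length xs = p \<and> length ys = p \<and> (\<forall>i<p. (xs ! i, ys ! i) \<in> r)
        \<longrightarrow> (g xs, g ys) \<in> r)"

definition stable :: "('a, 'o) algebra \<Rightarrow> ('a \<times> 'a) set \<Rightarrow> bool" where
  "stable \<A> r \<longleftrightarrow> (\<forall>\<xi>\<in>symbols \<A>. compatible r (arity \<A> \<xi>) (interp \<A> \<xi>))"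

definition stable_preorder :: "('a, 'o) algebra \<Rightarrow> ('a \<times> 'a) set \<Rightarrow> bool" where
  "stable_preorder \<A> r \<longleftrightarrow> preorder_on (carrier \<A>) r \<and> stable \<A> r"

definition congruence :: "('a, 'o) algebra \<Rightarrow> ('a \<times> 'a) set \<Rightarrow> bool" where
  "congruence \<A> r \<longleftrightarrow> equiv (carrier \<A>) r \<and> stable \<A> r"

definition stable_preorder_preserving :: "('a, 'o) algebra \<Rightarrow> ('a \<Rightarrow> 'a) \<Rightarrow> bool" where
  "stable_preorder_preserving \<A> f \<longleftrightarrow>
     (\<forall>r. stable_preorder \<A> r \<longrightarrow> compatible r 1 (\<lambda>xs. f (hd xs)))"

definition congruence_preserving :: "('a, 'o) algebra \<Rightarrow> ('a \<Rightarrow> 'a) \<Rightarrow> bool" where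
  "congruence_preserving \<A> f \<longleftrightarrow>
     (\<forall>r. congruence \<A> r \<longrightarrow> compatible r 1 (\<lambda>xs. f (hd xs)))"

section \<open>Residual finiteness\<close>

definition finite_index :: "'a set \<Rightarrow> ('a \<times> 'a) set \<Rightarrow> bool" where
  "finite_index A r \<longleftrightarrow> finite (A // r)"

definition finite_index_preorder :: "'a set \<Rightarrow> ('a \<times> 'a) set \<Rightarrow> bool" where
  "finite_index_preorder A r \<longleftrightarrow> finite_index A (r \<inter> r\<inverse>)"

text \<open>
  The intersection with \<open>A \<times> A\<close> only affects the empty family, whose intersection is thus the
  full relation on the carrier.
\<close>

definition c_residually_finite_rel :: "('a, 'o) algebra \<Rightarrow> ('a \<times> 'a) set \<Rightarrow> bool" where
  "c_residually_finite_rel \<A> r \<longleftrightarrow>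
     (\<exists>F. (\<forall>s\<in>F. congruence \<A> s \<and> finite_index (carrier \<A>) s) \<and>
          r = (carrier \<A> \<times> carrier \<A>) \<inter> \<Inter>F)"

definition sp_residually_finite_rel :: "('a, 'o) algebra \<Rightarrow> ('a \<times> 'a) set \<Rightarrow> bool" where
  "sp_residually_finite_rel \<A> r \<longleftrightarrow>
     (\<exists>F. (\<forall>s\<in>F. stable_preorder \<A> s \<and> finite_index_preorder (carrier \<A>) s) \<and>
          r = (carrier \<A> \<times> carrier \<A>) \<inter> \<Inter>F)"

definition c_residually_finite :: "('a, 'o) algebra \<Rightarrow> bool" where
  "c_residually_finite \<A> \<longleftrightarrow> (\<forall>r. congruence \<A> r \<longrightarrow> c_residually_finite_rel \<A> r)"

definition sp_residually_finite :: "('a, 'o) algebra \<Rightarrow> bool" where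
  "sp_residually_finite \<A> \<longleftrightarrow> (\<forall>r. stable_preorder \<A> r \<longrightarrow> sp_residually_finite_rel \<A> r)"

section \<open>Recognizable subsets\<close>

definition same_signature :: "('a, 'o) algebra \<Rightarrow> ('b, 'o) algebra \<Rightarrow> bool" where
  "same_signature \<A> \<M> \<longleftrightarrow> symbols \<M> = symbols \<A> \<and> (\<forall>\<xi>\<in>symbols \<A>. arity \<M> \<xi> = arity \<A> \<xi>)"

definition morphism :: "('a, 'o) algebra \<Rightarrow> ('b, 'o) algebra \<Rightarrow> ('a \<Rightarrow> 'b) \<Rightarrow> bool" where
  "morphism \<A> \<M> \<phi> \<longleftrightarrow> \<phi> \<in> carrier \<A> \<rightarrow> carrier \<M> \<and>
     (\<forall>\<xi>\<in>symbols \<A>. \<forall>xs\<in>tuples (carrier \<A>) (arity \<A> \<xi>).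
        \<phi> (interp \<A> \<xi> xs) = interp \<M> \<xi> (map \<phi> xs))"

definition recognizes ::
  "('a, 'o) algebra \<Rightarrow> ('b, 'o) algebra \<Rightarrow> ('a \<Rightarrow> 'b) \<Rightarrow> 'a set \<Rightarrow> bool" where
  "recognizes \<A> \<M> \<phi> L \<longleftrightarrow>
     is_algebra \<M> \<and> finite (carrier \<M>) \<and> same_signature \<A> \<M> \<and>
     morphism \<A> \<M> \<phi> \<and> \<phi> ` carrier \<A> = carrier \<M> \<and>
     L = \<phi> -` (\<phi> ` L) \<inter> carrier \<A>"

text \<open>
  HOL cannot quantify over the type of the carrier of the finite algebra. Taking it to be a set of
  natural numbers loses nothing, see \<open>recognizable_if_recognizes\<close> below.
\<close>

definition recognizable :: "('a, 'o) algebra \<Rightarrow> 'a set \<Rightarrow> bool" where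
  "recognizable \<A> L \<longleftrightarrow>
     L \<subseteq> carrier \<A> \<and> (\<exists>(\<M> :: (nat, 'o) algebra) \<phi>. recognizes \<A> \<M> \<phi> L)"

lemma recognizable_if_recognizes:
  fixes \<A> :: "('a, 'o) algebra" and \<M> :: "('b, 'o) algebra"
  assumes rec: "recognizes \<A> \<M> \<phi> L" and L: "L \<subseteq> carrier \<A>"
  shows "recognizable \<A> L"
proof -
  let ?A = "carrier \<A>" and ?M = "carrier \<M>"
  have alg: "is_algebra \<M>" and fin: "finite ?M" and sig: "same_signature \<A> \<M>"
    and mor: "morphism \<A> \<M> \<phi>" and surj: "\<phi> ` ?A = ?M" and Leq: "L = \<phi> -` (\<phi> ` L) \<inter> ?A"
    using rec by (auto simp: recognizes_def)
  obtain h :: "'b \<Rightarrow> nat" where h: "inj_on h ?M"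
    using fin finite_imp_inj_to_nat_seg by blast
  define k where "k = inv_into ?M h"
  have kh: "k (h m) = m" if "m \<in> ?M" for m
    using that h by (simp add: k_def)
  define N :: "(nat, 'o) algebra" where
    "N = \<lparr>carrier = h ` ?M, symbols = symbols \<M>, arity = arity \<M>,
          interp = (\<lambda>\<xi> xs. h (interp \<M> \<xi> (map k xs)))\<rparr>"
  have ktup: "map k xs \<in> tuples ?M n" if "xs \<in> tuples (h ` ?M) n" for xs n
    using that kh by (auto simp: tuples_def)
  have phiM: "\<phi> x \<in> ?M" if "x \<in> ?A" for x
    using that surj by blast
  have algN: "is_algebra N"
    using alg ktup unfolding is_algebra_def N_def by (auto simp: Pi_iff)
  have khmap: "map (k \<circ> (h \<circ> \<phi>)) xs = map \<phi> xs" if "xs \<in> tuples ?A n" for xs n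
    using that kh phiM by (auto simp: tuples_def)
  have morN: "morphism \<A> N (h \<circ> \<phi>)"
    unfolding morphism_def
  proof (intro conjI ballI)
    show "h \<circ> \<phi> \<in> carrier \<A> \<rightarrow> carrier N"
      using phiM by (simp add: N_def)
  next
    fix \<xi> xs assume s: "\<xi> \<in> symbols \<A>" and xs: "xs \<in> tuples ?A (arity \<A> \<xi>)"
    have "map k (map (h \<circ> \<phi>) xs) = map \<phi> xs"
      using khmap[OF xs] unfolding map_map .
    then show "(h \<circ> \<phi>) (interp \<A> \<xi> xs) = interp N \<xi> (map (h \<circ> \<phi>) xs)"
      using mor s xs unfolding morphism_def by (simp add: N_def del: map_map)
  qed
  have "x \<in> L" if x: "x \<in> ?A" and "h (\<phi> x) \<in> h ` \<phi> ` L" for x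
  proof -
    from that obtain y where y: "y \<in> L" "h (\<phi> x) = h (\<phi> y)" by auto
    then have "\<phi> x = \<phi> y"
      using inj_onD[OF h] phiM x L by blast
    with y x show ?thesis by (subst Leq) auto
  qed
  then have LN: "L = (h \<circ> \<phi>) -` ((h \<circ> \<phi>) ` L) \<inter> ?A"
    using L by (auto simp: image_comp)
  have "recognizes \<A> N (h \<circ> \<phi>) L"
    unfolding recognizes_def
  proof (intro conjI)
    show "finite (carrier N)" and "same_signature \<A> N"
      using fin sig by (simp_all add: N_def same_signature_def)
    show "(h \<circ> \<phi>) ` ?A = carrier N"
      by (simp only: image_comp [symmetric] surj) (simp add: N_def)
  qed (fact algN morN LN)+
  with L show ?thesis
    unfolding recognizable_def by blast
qed

section \<open>Freezifications\<close>

text \<open>Argument positions are counted from \<open>0\<close>; the frozen entry \<open>cs ! i\<close> is overwritten.\<close>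

definition one_freezifications :: "('a, 'o) algebra \<Rightarrow> ('a \<Rightarrow> 'a) set" where
  "one_freezifications \<A> =
     {(\<lambda>x. interp \<A> \<xi> [x]) | \<xi>. \<xi> \<in> symbols \<A> \<and> arity \<A> \<xi> = 1} \<union>
     {(\<lambda>x. interp \<A> \<xi> (cs[i := x])) | \<xi> cs i. \<xi> \<in> symbols \<A> \<and> arity \<A> \<xi> \<ge> 2 \<and>
        cs \<in> tuples (carrier \<A>) (arity \<A> \<xi>) \<and> i < arity \<A> \<xi>}"

inductive_set Frz_star :: "('a, 'o) algebra \<Rightarrow> ('a \<Rightarrow> 'a) set" for \<A> :: "('a, 'o) algebra" where
  Frz_id: "id \<in> Frz_star \<A>"
| Frz_comp: "\<gamma> \<in> one_freezifications \<A> \<Longrightarrow> \<delta> \<in> Frz_star \<A> \<Longrightarrow> \<gamma> \<circ> \<delta> \<in> Frz_star \<A>"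

section \<open>Lattices and Boolean algebras of subsets\<close>

definition lattice_of_subsets :: "'a set \<Rightarrow> 'a set set \<Rightarrow> bool" where
  "lattice_of_subsets A \<C> \<longleftrightarrow> \<C> \<subseteq> Pow A \<and> A \<in> \<C> \<and> {} \<in> \<C> \<and>
     (\<forall>X\<in>\<C>. \<forall>Y\<in>\<C>. X \<union> Y \<in> \<C> \<and> X \<inter> Y \<in> \<C>)"

definition boolean_algebra_of_subsets :: "'a set \<Rightarrow> 'a set set \<Rightarrow> bool" where
  "boolean_algebra_of_subsets A \<C> \<longleftrightarrow> lattice_of_subsets A \<C> \<and> (\<forall>X\<in>\<C>. A - X \<in> \<C>)"

definition closed_under_Frz_star :: "('a, 'o) algebra \<Rightarrow> 'a set set \<Rightarrow> bool" where
  "closed_under_Frz_star \<A> \<C> \<longleftrightarrow> (\<forall>X\<in>\<C>. \<forall>\<gamma>\<in>Frz_star \<A>. \<gamma> -` X \<inter> carrier \<A> \<in> \<C>)"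

definition generated_lattice :: "('a, 'o) algebra \<Rightarrow> 'a set \<Rightarrow> 'a set set" where
  "generated_lattice \<A> L =
     \<Inter>{\<C>. lattice_of_subsets (carrier \<A>) \<C> \<and> L \<in> \<C> \<and> closed_under_Frz_star \<A> \<C>}"

definition generated_boolean_algebra :: "('a, 'o) algebra \<Rightarrow> 'a set \<Rightarrow> 'a set set" where
  "generated_boolean_algebra \<A> L =
     \<Inter>{\<C>. boolean_algebra_of_subsets (carrier \<A>) \<C> \<and> L \<in> \<C> \<and> closed_under_Frz_star \<A> \<C>}"

end

theory Submission
  imports Defs
begin

text \<open>
  Both parts follow one scheme: a preservation property of \<open>f\<close> is turned into a membership of
  preimages by means of a syntactic relation, and back by means of principal up-sets.

  Suppose first that \<open>f\<close> preserves stable preorders, and let \<open>L\<close> be recognizable. Order the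
  carrier by \<open>x \<preceq> y\<close> iff \<open>\<gamma> x \<in> L\<close> implies \<open>\<gamma> y \<in> L\<close> for all \<open>\<gamma> \<in> Frz_star \<A>\<close>. Since
  stability of a preorder can be tested on unary translations, one argument being changed at a
  time, \<open>\<preceq>\<close> is a stable preorder (\<open>stable_preorder_syntactic\<close>), so \<open>f\<close> preserves it. As \<open>L\<close> is
  an up-set of \<open>\<preceq>\<close>, so is its preimage under \<open>f\<close>. A recognizable set has only finitely many
  translates \<open>\<gamma> -` L\<close> (\<open>finite_translates\<close>), because each of them is a union of classes of one
  congruence of finite index. Hence every up-set of \<open>\<preceq>\<close> is a finite union of finite
  intersections of translates (\<open>upset_in_lattice\<close>), which puts it in the generated lattice. If
  \<open>f\<close> only preserves congruences, the same argument applies to the equivalence induced by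
  \<open>\<preceq>\<close>; complements of translates are then used as well, and the set obtained lies in the
  generated Boolean algebra.

  Conversely, residual finiteness reduces preservation of an arbitrary stable preorder to that of
  a stable preorder \<open>s\<close> of finite index. For it the principal up-set \<open>L = s `` {f x}\<close> is
  recognizable (\<open>recognizable_Image\<close>), by the quotient modulo the equivalence induced by \<open>s\<close>.
  The up-sets of \<open>s\<close> form a lattice closed under the preimages by \<open>Frz_star \<A>\<close>, and a Boolean
  algebra if \<open>s\<close> is symmetric, so the preimage of \<open>L\<close> under \<open>f\<close> is an up-set of \<open>s\<close>. It
  contains \<open>x\<close>, hence every \<open>y\<close> above \<open>x\<close>, which says \<open>(f x, f y) \<in> s\<close>.
\<close>

section \<open>Stable preorders and unary translations\<close>

lemma compatible_unary_iff:
  "compatible r 1 (\<lambda>xs. f (hd xs)) \<longleftrightarrow> (\<forall>x y. (x, y) \<in> r \<longrightarrow> (f x, f y) \<in> r)"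
proof
  assume c: "compatible r 1 (\<lambda>xs. f (hd xs))"
  have "(f x, f y) \<in> r" if "(x, y) \<in> r" for x y
    using c[unfolded compatible_def, rule_format, of "[x]" "[y]"] that by simp
  then show "\<forall>x y. (x, y) \<in> r \<longrightarrow> (f x, f y) \<in> r"
    by blast
next
  assume "\<forall>x y. (x, y) \<in> r \<longrightarrow> (f x, f y) \<in> r"
  then show "compatible r 1 (\<lambda>xs. f (hd xs))"
    by (auto simp: compatible_def length_Suc_conv)
qed

lemma interp_closed:
  assumes "is_algebra \<A>" "\<xi> \<in> symbols \<A>" "xs \<in> tuples (carrier \<A>) (arity \<A> \<xi>)"
  shows "interp \<A> \<xi> xs \<in> carrier \<A>"
  using assms by (auto simp: is_algebra_def)

lemma freezing_in_one_freezifications: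
  assumes \<xi>: "\<xi> \<in> symbols \<A>" and cs: "cs \<in> tuples (carrier \<A>) (arity \<A> \<xi>)"
    and i: "i < arity \<A> \<xi>"
  shows "(\<lambda>x. interp \<A> \<xi> (cs[i := x])) \<in> one_freezifications \<A>"
proof (cases "arity \<A> \<xi> = 1")
  case True
  then obtain c where "cs = [c]"
    using cs by (auto simp: tuples_def length_Suc_conv)
  with True i have "(\<lambda>x. interp \<A> \<xi> (cs[i := x])) = (\<lambda>x. interp \<A> \<xi> [x])"
    by simp
  with True \<xi> show ?thesis
    unfolding one_freezifications_def by blast
next
  case False
  with i have "arity \<A> \<xi> \<ge> 2"
    by simp
  with \<xi> cs i show ?thesis
    unfolding one_freezifications_def by blast
qed

lemma one_freezificationsE:
  assumes "\<gamma> \<in> one_freezifications \<A>" and ne: "carrier \<A> \<noteq> {}"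
  obtains \<xi> cs i where "\<xi> \<in> symbols \<A>" "cs \<in> tuples (carrier \<A>) (arity \<A> \<xi>)"
    "i < arity \<A> \<xi>" "\<gamma> = (\<lambda>x. interp \<A> \<xi> (cs[i := x]))"
proof -
  obtain a where a: "a \<in> carrier \<A>"
    using ne by blast
  consider (unary) \<xi> where "\<xi> \<in> symbols \<A>" "arity \<A> \<xi> = 1" "\<gamma> = (\<lambda>x. interp \<A> \<xi> [x])"
    | (more) \<xi> cs i where "\<xi> \<in> symbols \<A>" "cs \<in> tuples (carrier \<A>) (arity \<A> \<xi>)"
        "i < arity \<A> \<xi>" "\<gamma> = (\<lambda>x. interp \<A> \<xi> (cs[i := x]))"
    using assms(1) unfolding one_freezifications_def by blast
  then show thesis
  proof cases
    case unary
    \<comment> \<open>The only entry of the tuple is overwritten, so any element of the carrier will do.\<close>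
    then show thesis
      using a by (intro that[of \<xi> "[a]" 0]) (auto simp: tuples_def)
  next
    case more
    then show thesis
      by (rule that)
  qed
qed

lemma Frz_star_comp:
  assumes "\<gamma> \<in> Frz_star \<A>" "\<delta> \<in> Frz_star \<A>"
  shows "\<gamma> \<circ> \<delta> \<in> Frz_star \<A>"
  using assms by (induction rule: Frz_star.induct) (auto simp: comp_assoc intro: Frz_comp)

lemma one_freezification_in_Frz_star:
  assumes "\<gamma> \<in> one_freezifications \<A>"
  shows "\<gamma> \<in> Frz_star \<A>"
  using Frz_comp[OF assms Frz_id] by simp

lemma one_freezification_closed:
  assumes alg: "is_algebra \<A>" and \<gamma>: "\<gamma> \<in> one_freezifications \<A>" and x: "x \<in> carrier \<A>"
  shows "\<gamma> x \<in> carrier \<A>"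
proof -
  have "carrier \<A> \<noteq> {}"
    using x by blast
  with \<gamma> obtain \<xi> cs i where "\<xi> \<in> symbols \<A>" "cs \<in> tuples (carrier \<A>) (arity \<A> \<xi>)"
      "\<gamma> = (\<lambda>x. interp \<A> \<xi> (cs[i := x]))"
    by (rule one_freezificationsE)
  moreover from this x have "cs[i := x] \<in> tuples (carrier \<A>) (arity \<A> \<xi>)"
    using set_update_subset_insert[of cs i x] by (auto simp: tuples_def)
  ultimately show ?thesis
    using alg by (simp add: interp_closed)
qed

lemma stable_preorderD:
  assumes "stable_preorder \<A> r"
  shows "r \<subseteq> carrier \<A> \<times> carrier \<A>" and "\<And>x. x \<in> carrier \<A> \<Longrightarrow> (x, x) \<in> r"
    and "\<And>x y z. (x, y) \<in> r \<Longrightarrow> (y, z) \<in> r \<Longrightarrow> (x, z) \<in> r"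
    and "\<And>\<xi>. \<xi> \<in> symbols \<A> \<Longrightarrow> compatible r (arity \<A> \<xi>) (interp \<A> \<xi>)"
  using assms
  by (auto simp: stable_preorder_def preorder_on_def stable_def refl_on_def dest: transD)

lemma congruence_iff_sym_stable_preorder:
  "congruence \<A> r \<longleftrightarrow> stable_preorder \<A> r \<and> sym r"
  by (auto simp: congruence_def stable_preorder_def equiv_def preorder_on_def)

lemma one_freezification_mono:
  assumes r: "stable_preorder \<A> r" and \<gamma>: "\<gamma> \<in> one_freezifications \<A>" and xy: "(x, y) \<in> r"
  shows "(\<gamma> x, \<gamma> y) \<in> r"
proof -
  have "carrier \<A> \<noteq> {}"
    using stable_preorderD(1)[OF r] xy by blast
  with \<gamma> obtain \<xi> cs i where \<xi>: "\<xi> \<in> symbols \<A>"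
      and cs: "cs \<in> tuples (carrier \<A>) (arity \<A> \<xi>)" and i: "i < arity \<A> \<xi>"
      and \<gamma>_eq: "\<gamma> = (\<lambda>x. interp \<A> \<xi> (cs[i := x]))"
    by (rule one_freezificationsE)
  have "(cs[i := x] ! j, cs[i := y] ! j) \<in> r" if "j < arity \<A> \<xi>" for j
    using that cs xy stable_preorderD(2)[OF r] by (cases "j = i") (auto simp: tuples_def subset_iff)
  then show ?thesis
    using stable_preorderD(4)[OF r \<xi>] cs unfolding compatible_def \<gamma>_eq
    by (auto simp: tuples_def)
qed

lemma Frz_star_mono:
  assumes "stable_preorder \<A> r" "\<gamma> \<in> Frz_star \<A>" "(x, y) \<in> r"
  shows "(\<gamma> x, \<gamma> y) \<in> r"
  using assms(2,3)
  by (induction rule: Frz_star.induct) (auto intro: one_freezification_mono[OF assms(1)])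

text \<open>
  Two tuples related componentwise are joined by a chain of tuples in which each one differs from
  the previous one at a single position. Consecutive values of an operation along the chain are
  then related by a freezification, and transitivity relates the two ends. For a constant
  the chain is trivial, and reflexivity is what is needed.
\<close>

lemma stable_if_one_freezifications_mono:
  assumes alg: "is_algebra \<A>" and r: "preorder_on (carrier \<A>) r"
    and mono: "\<And>\<gamma> x y. \<gamma> \<in> one_freezifications \<A> \<Longrightarrow> (x, y) \<in> r \<Longrightarrow> (\<gamma> x, \<gamma> y) \<in> r"
  shows "stable \<A> r"
  unfolding stable_def compatible_def
proof (intro ballI allI impI, elim conjE)
  fix \<xi> xs ys
  let ?n = "arity \<A> \<xi>"
  assume \<xi>: "\<xi> \<in> symbols \<A>" and len: "length xs = ?n" "length ys = ?n"
    and rel: "\<forall>i<?n. (xs ! i, ys ! i) \<in> r"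
  have sub: "r \<subseteq> carrier \<A> \<times> carrier \<A>" and refl: "refl_on (carrier \<A>) r" and trans: "trans r"
    using r by (auto simp: preorder_on_def)
  have xs: "set xs \<subseteq> carrier \<A>" and ys: "set ys \<subseteq> carrier \<A>"
    using rel sub len by (fastforce simp: in_set_conv_nth)+
  define h where "h k = take k ys @ drop k xs" for k
  have h: "h k \<in> tuples (carrier \<A>) ?n" for k
    using xs ys len set_take_subset[of k ys] set_drop_subset[of k xs]
    by (auto simp: h_def tuples_def)
  have "(interp \<A> \<xi> xs, interp \<A> \<xi> (h k)) \<in> r" if "k \<le> ?n" for k
    using that
  proof (induction k)
    case 0
    have "interp \<A> \<xi> xs \<in> carrier \<A>"
      using alg \<xi> h[of 0] by (auto simp: h_def interp_closed)
    then show ?case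
      using refl by (simp add: h_def refl_on_def)
  next
    case (Suc k)
    then have k: "k < ?n"
      by simp
    have "h k = (h k)[k := xs ! k]"
      using k len by (intro nth_equalityI) (auto simp: h_def nth_append nth_list_update)
    moreover have "h (Suc k) = (h k)[k := ys ! k]"
      using k len
      by (intro nth_equalityI) (auto simp: h_def nth_append nth_list_update less_Suc_eq)
    moreover have "(interp \<A> \<xi> ((h k)[k := xs ! k]), interp \<A> \<xi> ((h k)[k := ys ! k])) \<in> r"
      using mono[OF freezing_in_one_freezifications[OF \<xi> h k]] rel k by simp
    ultimately have "(interp \<A> \<xi> (h k), interp \<A> \<xi> (h (Suc k))) \<in> r"
      by simp
    with Suc show ?case
      by (meson Suc_leD transD trans)
  qed
  from this[of ?n] show "(interp \<A> \<xi> xs, interp \<A> \<xi> ys) \<in> r"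
    using len by (simp add: h_def)
qed

lemma congruence_Int_converse:
  assumes "stable_preorder \<A> r"
  shows "congruence \<A> (r \<inter> r\<inverse>)"
proof -
  note rD = stable_preorderD[OF assms]
  have "equiv (carrier \<A>) (r \<inter> r\<inverse>)"
    using rD(1,2) by (intro equivI) (auto simp: refl_on_def sym_def trans_def intro: rD(3))
  moreover have "compatible (r \<inter> r\<inverse>) (arity \<A> \<xi>) (interp \<A> \<xi>)" if "\<xi> \<in> symbols \<A>" for \<xi>
    using rD(4)[OF that] by (simp add: compatible_def)
  ultimately show ?thesis
    by (simp add: congruence_def stable_def)
qed

section \<open>Finite quotients and recognizable sets\<close>

text \<open>
  The recognizing morphism is the projection onto the quotient algebra, whose operations are
  computed on arbitrarily chosen representatives.
\<close>

lemma recognizable_if_saturated: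
  fixes \<A> :: "('a, 'o) algebra"
  assumes alg: "is_algebra \<A>" and e: "congruence \<A> e" and fin: "finite_index (carrier \<A>) e"
    and L: "L \<subseteq> carrier \<A>" and sat: "e `` L \<subseteq> L"
  shows "recognizable \<A> L"
proof -
  let ?A = "carrier \<A>"
  define cl where "cl x = e `` {x}" for x
  define rep where "rep X = (SOME x. x \<in> X)" for X :: "'a set"
  define Q :: "('a set, 'o) algebra" where
    "Q = \<lparr>carrier = ?A // e, symbols = symbols \<A>, arity = arity \<A>,
          interp = (\<lambda>\<xi> Xs. cl (interp \<A> \<xi> (map rep Xs)))\<rparr>"
  have equiv: "equiv ?A e" and stable: "stable \<A> e"
    using e by (auto simp: congruence_def)
  have cl_in: "cl x \<in> ?A // e" if "x \<in> ?A" for x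
    using that by (simp add: cl_def quotientI)
  have rep_cl: "(x, rep (cl x)) \<in> e" if "x \<in> ?A" for x
    using someI[of "\<lambda>y. y \<in> cl x", OF equiv_class_self[OF equiv that, folded cl_def]]
    by (simp add: rep_def cl_def)
  have rep_in: "rep X \<in> ?A" if "X \<in> ?A // e" for X
    using that rep_cl equiv by (fastforce elim!: quotientE simp: cl_def equiv_def)
  have "is_algebra Q"
    unfolding is_algebra_def
  proof (intro conjI ballI funcsetI)
    show "carrier Q \<noteq> {}"
      using alg cl_in by (auto simp: Q_def is_algebra_def)
  next
    fix \<xi> Xs
    assume "\<xi> \<in> symbols Q" and Xs: "Xs \<in> tuples (carrier Q) (arity Q \<xi>)"
    then have "\<xi> \<in> symbols \<A>"
      by (simp add: Q_def)
    moreover have "map rep Xs \<in> tuples ?A (arity \<A> \<xi>)"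
      using Xs rep_in by (auto simp: Q_def tuples_def)
    ultimately show "interp Q \<xi> Xs \<in> carrier Q"
      using alg by (simp add: Q_def cl_in interp_closed)
  qed
  moreover have "morphism \<A> Q cl"
    unfolding morphism_def
  proof (intro conjI ballI funcsetI)
    show "cl x \<in> carrier Q" if "x \<in> ?A" for x
      using that by (simp add: Q_def cl_in)
  next
    fix \<xi> xs
    assume \<xi>: "\<xi> \<in> symbols \<A>" and xs: "xs \<in> tuples ?A (arity \<A> \<xi>)"
    have "compatible e (arity \<A> \<xi>) (interp \<A> \<xi>)"
      using \<xi> stable by (simp add: stable_def)
    moreover have "(xs ! i, map rep (map cl xs) ! i) \<in> e" if "i < arity \<A> \<xi>" for i
      using that xs rep_cl by (auto simp: tuples_def subset_iff)
    ultimately have "(interp \<A> \<xi> xs, interp \<A> \<xi> (map rep (map cl xs))) \<in> e"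
      using xs unfolding compatible_def by (auto simp: tuples_def)
    then show "cl (interp \<A> \<xi> xs) = interp Q \<xi> (map cl xs)"
      using equiv by (simp add: Q_def cl_def equiv_class_eq)
  qed
  moreover have "cl ` ?A = carrier Q"
    by (auto simp: Q_def cl_def quotient_def)
  moreover have "x \<in> L" if "x \<in> ?A" "y \<in> L" "cl x = cl y" for x y
  proof -
    have "(y, x) \<in> e"
      using that equiv by (metis cl_def eq_equiv_class)
    with that sat show ?thesis
      by blast
  qed
  then have "L = cl -` (cl ` L) \<inter> ?A"
    using L by auto
  ultimately have "recognizes \<A> Q cl L"
    using fin by (simp add: recognizes_def same_signature_def Q_def finite_index_def)
  then show ?thesis
    using L by (rule recognizable_if_recognizes)
qed

lemma recognizable_Image:
  assumes alg: "is_algebra \<A>" and s: "stable_preorder \<A> s"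
    and fin: "finite_index_preorder (carrier \<A>) s"
  shows "recognizable \<A> (s `` {a})"
proof (rule recognizable_if_saturated[OF alg congruence_Int_converse[OF s]])
  show "finite_index (carrier \<A>) (s \<inter> s\<inverse>)"
    using fin by (simp add: finite_index_preorder_def)
  show "s `` {a} \<subseteq> carrier \<A>" "(s \<inter> s\<inverse>) `` (s `` {a}) \<subseteq> s `` {a}"
    using stable_preorderD(1,3)[OF s] by blast+
qed

text \<open>
  Translations preserve the kernel of a recognizing morphism \<open>\<phi>\<close>, so all translates of \<open>L\<close> are
  preimages under \<open>\<phi>\<close> of subsets of one finite set.
\<close>

lemma finite_translates:
  assumes alg: "is_algebra \<A>" and rec: "recognizable \<A> L"
  shows "finite {\<gamma> -` L \<inter> carrier \<A> | \<gamma>. \<gamma> \<in> Frz_star \<A>}"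
proof -
  let ?A = "carrier \<A>"
  obtain \<M> :: "(nat, 'b) algebra" and \<phi> where fin: "finite (carrier \<M>)"
    and mor: "morphism \<A> \<M> \<phi>" and L: "L = \<phi> -` (\<phi> ` L) \<inter> ?A"
    using rec by (auto simp: recognizable_def recognizes_def)
  define k where "k = {(x, y) \<in> ?A \<times> ?A. \<phi> x = \<phi> y}"
  have "compatible k (arity \<A> \<xi>) (interp \<A> \<xi>)" if \<xi>: "\<xi> \<in> symbols \<A>" for \<xi>
    unfolding compatible_def
  proof (intro allI impI, elim conjE)
    fix xs ys
    assume len: "length xs = arity \<A> \<xi>" "length ys = arity \<A> \<xi>"
      and rel: "\<forall>i<arity \<A> \<xi>. (xs ! i, ys ! i) \<in> k"
    have "map \<phi> xs = map \<phi> ys"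
      using len rel by (intro nth_equalityI) (auto simp: k_def)
    moreover have "xs \<in> tuples ?A (arity \<A> \<xi>)" "ys \<in> tuples ?A (arity \<A> \<xi>)"
      using len rel by (fastforce simp: tuples_def k_def in_set_conv_nth)+
    ultimately show "(interp \<A> \<xi> xs, interp \<A> \<xi> ys) \<in> k"
      using mor \<xi> alg by (simp add: k_def morphism_def interp_closed)
  qed
  then have "stable_preorder \<A> k"
    by (auto simp: stable_preorder_def stable_def preorder_on_def refl_on_def k_def
        intro!: transI)
  note kernel = Frz_star_mono[OF this]
  have sat: "\<gamma> -` L \<inter> ?A = \<phi> -` (\<phi> ` (\<gamma> -` L \<inter> ?A)) \<inter> ?A" if \<gamma>: "\<gamma> \<in> Frz_star \<A>" for \<gamma>
  proof -
    have "\<gamma> x \<in> L" if "x \<in> ?A" "y \<in> ?A" "\<phi> x = \<phi> y" "\<gamma> y \<in> L" for x y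
    proof -
      have "(\<gamma> x, \<gamma> y) \<in> k"
        using that by (intro kernel[OF \<gamma>]) (simp add: k_def)
      with that show ?thesis
        by (subst L) (auto simp: k_def)
    qed
    then show ?thesis
      by auto
  qed
  have "\<phi> ` (\<gamma> -` L \<inter> ?A) \<in> Pow (carrier \<M>)" for \<gamma>
    using mor by (auto simp: morphism_def)
  then have "\<gamma> -` L \<inter> ?A \<in> (\<lambda>P. \<phi> -` P \<inter> ?A) ` Pow (carrier \<M>)"
    if "\<gamma> \<in> Frz_star \<A>" for \<gamma>
    using sat[OF that] by (rule image_eqI[rotated])
  then have "{\<gamma> -` L \<inter> ?A | \<gamma>. \<gamma> \<in> Frz_star \<A>} \<subseteq> (\<lambda>P. \<phi> -` P \<inter> ?A) ` Pow (carrier \<M>)"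
    by blast
  then show ?thesis
    by (rule finite_subset) (simp add: fin)
qed

section \<open>The syntactic preorder of a set\<close>

definition syntactic_preorder :: "('a, 'o) algebra \<Rightarrow> 'a set \<Rightarrow> ('a \<times> 'a) set" where
  "syntactic_preorder \<A> L =
     {(x, y) \<in> carrier \<A> \<times> carrier \<A>. \<forall>\<gamma>\<in>Frz_star \<A>. \<gamma> x \<in> L \<longrightarrow> \<gamma> y \<in> L}"

lemma stable_preorder_syntactic:
  assumes alg: "is_algebra \<A>"
  shows "stable_preorder \<A> (syntactic_preorder \<A> L)"
proof -
  let ?r = "syntactic_preorder \<A> L"
  have r: "preorder_on (carrier \<A>) ?r"
    by (auto simp: syntactic_preorder_def preorder_on_def refl_on_def intro!: transI)
  have "(\<delta> x, \<delta> y) \<in> ?r" if \<delta>: "\<delta> \<in> one_freezifications \<A>" and xy: "(x, y) \<in> ?r" for \<delta> x y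
  proof -
    have "\<gamma> (\<delta> y) \<in> L" if "\<gamma> \<in> Frz_star \<A>" "\<gamma> (\<delta> x) \<in> L" for \<gamma>
      using xy that Frz_star_comp[OF that(1) one_freezification_in_Frz_star[OF \<delta>]]
      by (force simp: syntactic_preorder_def)
    then show ?thesis
      using xy one_freezification_closed[OF alg \<delta>] by (auto simp: syntactic_preorder_def)
  qed
  with alg r have "stable \<A> ?r"
    by (rule stable_if_one_freezifications_mono)
  with r show ?thesis
    by (simp add: stable_preorder_def)
qed

text \<open>
  If \<open>X\<close> is an up-set of the preorder that compares the members of \<open>G\<close> containing a point, then
  \<open>X\<close> is the union over \<open>x \<in> X\<close> of the sets \<open>A \<inter> \<Inter>{Z \<in> G. x \<in> Z}\<close>. Finiteness of \<open>G\<close> makes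
  the intersections finite, and leaves only finitely many of them.
\<close>

lemma upset_in_lattice:
  assumes lat: "lattice_of_subsets A \<C>" and fin: "finite G" and G: "G \<subseteq> \<C>" and X: "X \<subseteq> A"
    and up: "\<And>x y. x \<in> X \<Longrightarrow> y \<in> A \<Longrightarrow> (\<And>Z. Z \<in> G \<Longrightarrow> x \<in> Z \<Longrightarrow> y \<in> Z) \<Longrightarrow> y \<in> X"
  shows "X \<in> \<C>"
proof -
  have inter: "A \<inter> \<Inter>H \<in> \<C>" if "finite H" "H \<subseteq> \<C>" for H
    using that
  proof (induction H rule: finite_induct)
    case empty
    then show ?case
      using lat by (simp add: lattice_of_subsets_def)
  next
    case (insert Z H)
    then have "Z \<inter> (A \<inter> \<Inter>H) \<in> \<C>"
      using lat by (simp add: lattice_of_subsets_def)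
    then show ?case
      by (simp add: Int_left_commute)
  qed
  have union: "\<Union>H \<in> \<C>" if "finite H" "H \<subseteq> \<C>" for H
    using that
    by (induction H rule: finite_induct) (use lat in \<open>auto simp: lattice_of_subsets_def\<close>)
  define N where "N x = A \<inter> \<Inter>{Z \<in> G. x \<in> Z}" for x
  have "N ` X \<subseteq> (\<lambda>H. A \<inter> \<Inter>H) ` Pow G"
    by (auto simp: N_def)
  then have "finite (N ` X)"
    using fin by (simp add: finite_subset)
  moreover have "N ` X \<subseteq> \<C>"
    unfolding N_def using fin G by (intro image_subsetI inter) auto
  ultimately have "\<Union>(N ` X) \<in> \<C>"
    by (rule union)
  moreover have "\<Union>(N ` X) = X"
    using X by (auto simp: N_def intro: up)
  ultimately show ?thesis
    by simp
qed

lemma vimage_in_generated_lattice: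
  assumes alg: "is_algebra \<A>"
    and pres: "stable_preorder_preserving \<A> f" and rec: "recognizable \<A> L"
  shows "f -` L \<inter> carrier \<A> \<in> generated_lattice \<A> L"
  unfolding generated_lattice_def
proof (rule InterI, clarify)
  fix \<C>
  assume lat: "lattice_of_subsets (carrier \<A>) \<C>" and L: "L \<in> \<C>"
    and closed: "closed_under_Frz_star \<A> \<C>"
  let ?G = "{\<gamma> -` L \<inter> carrier \<A> | \<gamma>. \<gamma> \<in> Frz_star \<A>}"
  show "f -` L \<inter> carrier \<A> \<in> \<C>"
  proof (rule upset_in_lattice[OF lat finite_translates[OF alg rec]])
    show "?G \<subseteq> \<C>"
      using L closed by (auto simp: closed_under_Frz_star_def)
  next
    fix x y
    assume x: "x \<in> f -` L \<inter> carrier \<A>" and y: "y \<in> carrier \<A>"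
      and up: "\<And>Z. Z \<in> ?G \<Longrightarrow> x \<in> Z \<Longrightarrow> y \<in> Z"
    have "\<gamma> y \<in> L" if "\<gamma> \<in> Frz_star \<A>" "\<gamma> x \<in> L" for \<gamma>
      using up[of "\<gamma> -` L \<inter> carrier \<A>"] that x y by blast
    then have "(x, y) \<in> syntactic_preorder \<A> L"
      using x y by (simp add: syntactic_preorder_def)
    then have "(f x, f y) \<in> syntactic_preorder \<A> L"
      using pres stable_preorder_syntactic[OF alg]
      unfolding stable_preorder_preserving_def compatible_unary_iff by blast
    then have "id (f x) \<in> L \<longrightarrow> id (f y) \<in> L"
      using Frz_id unfolding syntactic_preorder_def by blast
    then show "y \<in> f -` L \<inter> carrier \<A>"
      using x y by simp
  qed simp
qed

text \<open>
  Adding the complements of the translates to the family \<open>G\<close> turns the comparison of points from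
  the syntactic preorder into the equivalence induced by it, which is a congruence.
\<close>

lemma vimage_in_generated_boolean_algebra:
  assumes alg: "is_algebra \<A>"
    and pres: "congruence_preserving \<A> f" and rec: "recognizable \<A> L"
  shows "f -` L \<inter> carrier \<A> \<in> generated_boolean_algebra \<A> L"
  unfolding generated_boolean_algebra_def
proof (rule InterI, clarify)
  fix \<C>
  assume bool: "boolean_algebra_of_subsets (carrier \<A>) \<C>" and L: "L \<in> \<C>"
    and closed: "closed_under_Frz_star \<A> \<C>"
  let ?G = "{\<gamma> -` L \<inter> carrier \<A> | \<gamma>. \<gamma> \<in> Frz_star \<A>}"
  let ?r = "syntactic_preorder \<A> L"
  have lat: "lattice_of_subsets (carrier \<A>) \<C>" and compl: "\<And>Z. Z \<in> \<C> \<Longrightarrow> carrier \<A> - Z \<in> \<C>"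
    using bool by (auto simp: boolean_algebra_of_subsets_def)
  have G: "?G \<subseteq> \<C>"
    using L closed by (auto simp: closed_under_Frz_star_def)
  show "f -` L \<inter> carrier \<A> \<in> \<C>"
  proof (rule upset_in_lattice[OF lat])
    show "finite (?G \<union> (\<lambda>Z. carrier \<A> - Z) ` ?G)"
      using finite_translates[OF alg rec] by blast
    show "?G \<union> (\<lambda>Z. carrier \<A> - Z) ` ?G \<subseteq> \<C>"
      using G compl by blast
  next
    fix x y
    assume x: "x \<in> f -` L \<inter> carrier \<A>" and y: "y \<in> carrier \<A>"
      and up: "\<And>Z. Z \<in> ?G \<union> (\<lambda>Z. carrier \<A> - Z) ` ?G \<Longrightarrow> x \<in> Z \<Longrightarrow> y \<in> Z"
    have "\<gamma> x \<in> L \<longleftrightarrow> \<gamma> y \<in> L" if "\<gamma> \<in> Frz_star \<A>" for \<gamma>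
    proof -
      let ?Z = "\<gamma> -` L \<inter> carrier \<A>"
      have Z: "?Z \<in> ?G"
        using that by blast
      show ?thesis
      proof
        assume "\<gamma> x \<in> L"
        with x have "x \<in> ?Z"
          by simp
        from up[OF UnI1[OF Z] this] show "\<gamma> y \<in> L"
          by simp
      next
        assume \<gamma>y: "\<gamma> y \<in> L"
        show "\<gamma> x \<in> L"
        proof (rule ccontr)
          assume "\<gamma> x \<notin> L"
          with x have "x \<in> carrier \<A> - ?Z"
            by simp
          from up[OF UnI2[OF imageI[OF Z]] this] \<gamma>y y show False
            by simp
        qed
      qed
    qed
    then have "(x, y) \<in> ?r \<inter> ?r\<inverse>"
      using x y by (simp add: syntactic_preorder_def)
    then have "(f x, f y) \<in> ?r \<inter> ?r\<inverse>"
      using pres[unfolded congruence_preserving_def compatible_unary_iff, rule_format,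
          OF congruence_Int_converse[OF stable_preorder_syntactic[OF alg]]]
      by simp
    then have "(f x, f y) \<in> ?r"
      by simp
    then have "id (f x) \<in> L \<longrightarrow> id (f y) \<in> L"
      using Frz_id unfolding syntactic_preorder_def by blast
    then show "y \<in> f -` L \<inter> carrier \<A>"
      using x y by simp
  qed simp
qed

section \<open>Up-sets of a stable preorder\<close>

definition upsets :: "'a set \<Rightarrow> ('a \<times> 'a) set \<Rightarrow> 'a set set" where
  "upsets A s = {X. X \<subseteq> A \<and> s `` X \<subseteq> X}"

lemma lattice_upsets:
  assumes "s \<subseteq> A \<times> A"
  shows "lattice_of_subsets A (upsets A s)"
  using assms unfolding lattice_of_subsets_def upsets_def by blast

lemma boolean_algebra_upsets:
  assumes "s \<subseteq> A \<times> A" "sym s"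
  shows "boolean_algebra_of_subsets A (upsets A s)"
  unfolding boolean_algebra_of_subsets_def
proof (intro conjI ballI)
  show "lattice_of_subsets A (upsets A s)"
    using assms(1) by (rule lattice_upsets)
  show "A - X \<in> upsets A s" if "X \<in> upsets A s" for X
  proof -
    have "y \<in> A - X" if "(x, y) \<in> s" "x \<in> A - X" for x y
    proof -
      have "(y, x) \<in> s"
        using assms(2) that(1) by (rule symD)
      with \<open>X \<in> upsets A s\<close> that assms(1) show ?thesis
        by (auto simp: upsets_def)
    qed
    then show ?thesis
      by (auto simp: upsets_def)
  qed
qed

lemma closed_under_Frz_star_upsets:
  assumes "stable_preorder \<A> s"
  shows "closed_under_Frz_star \<A> (upsets (carrier \<A>) s)"
  using stable_preorderD(1)[OF assms] Frz_star_mono[OF assms]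
  unfolding closed_under_Frz_star_def upsets_def by blast

lemma Image_in_upsets:
  assumes "stable_preorder \<A> s"
  shows "s `` {a} \<in> upsets (carrier \<A>) s"
  using stable_preorderD(1,3)[OF assms] unfolding upsets_def by blast

lemma generated_lattice_subset_upsets:
  assumes "stable_preorder \<A> s"
  shows "generated_lattice \<A> (s `` {a}) \<subseteq> upsets (carrier \<A>) s"
  unfolding generated_lattice_def
  using lattice_upsets[OF stable_preorderD(1)[OF assms]] Image_in_upsets[OF assms]
    closed_under_Frz_star_upsets[OF assms]
  by (intro Inter_lower) simp

lemma generated_boolean_algebra_subset_upsets:
  assumes "congruence \<A> s"
  shows "generated_boolean_algebra \<A> (s `` {a}) \<subseteq> upsets (carrier \<A>) s"
proof -
  have s: "stable_preorder \<A> s" and "sym s"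
    using assms by (auto simp: congruence_iff_sym_stable_preorder)
  then show ?thesis
    unfolding generated_boolean_algebra_def
    using boolean_algebra_upsets[OF stable_preorderD(1)[OF s]] Image_in_upsets[OF s]
      closed_under_Frz_star_upsets[OF s]
    by (intro Inter_lower) simp
qed

text \<open>
  Up-sets detect the order: by reflexivity \<open>x\<close> lies in the preimage of the principal up-set of
  \<open>f x\<close>, and \<open>y\<close> must follow.
\<close>

lemma mono_if_vimage_Image_upset:
  assumes s: "stable_preorder \<A> s" and f: "f \<in> carrier \<A> \<rightarrow> carrier \<A>"
    and up: "f -` (s `` {f x}) \<inter> carrier \<A> \<in> upsets (carrier \<A>) s" and xy: "(x, y) \<in> s"
  shows "(f x, f y) \<in> s"
proof -
  have "x \<in> carrier \<A>"
    using stable_preorderD(1)[OF s] xy by blast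
  then have "x \<in> f -` (s `` {f x}) \<inter> carrier \<A>"
    using stable_preorderD(2)[OF s] f by auto
  with up xy have "y \<in> f -` (s `` {f x})"
    unfolding upsets_def by blast
  then show ?thesis
    by simp
qed

lemma stable_preorder_preservingI:
  assumes alg: "is_algebra \<A>" and f: "f \<in> carrier \<A> \<rightarrow> carrier \<A>"
    and resid: "sp_residually_finite \<A>"
    and vimage: "\<And>L. recognizable \<A> L \<Longrightarrow> f -` L \<inter> carrier \<A> \<in> generated_lattice \<A> L"
  shows "stable_preorder_preserving \<A> f"
  unfolding stable_preorder_preserving_def compatible_unary_iff
proof (intro allI impI)
  fix r x y
  assume r: "stable_preorder \<A> r" and xy: "(x, y) \<in> r"
  have "sp_residually_finite_rel \<A> r"
    using resid r by (simp add: sp_residually_finite_def)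
  then obtain F where F: "\<forall>s\<in>F. stable_preorder \<A> s \<and> finite_index_preorder (carrier \<A>) s"
    and r_eq: "r = carrier \<A> \<times> carrier \<A> \<inter> \<Inter>F"
    unfolding sp_residually_finite_rel_def by (elim exE conjE)
  have "(f x, f y) \<in> s" if "s \<in> F" for s
  proof (rule mono_if_vimage_Image_upset[OF _ f])
    show s: "stable_preorder \<A> s" and "(x, y) \<in> s"
      using F xy r_eq that by auto
    show "f -` (s `` {f x}) \<inter> carrier \<A> \<in> upsets (carrier \<A>) s"
      using vimage[OF recognizable_Image[OF alg s]] generated_lattice_subset_upsets[OF s] F that
      by blast
  qed
  then show "(f x, f y) \<in> r"
    using f xy by (auto simp: r_eq)
qed

lemma congruence_preservingI:
  assumes alg: "is_algebra \<A>" and f: "f \<in> carrier \<A> \<rightarrow> carrier \<A>"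
    and resid: "c_residually_finite \<A>"
    and vimage: "\<And>L. recognizable \<A> L \<Longrightarrow> f -` L \<inter> carrier \<A> \<in> generated_boolean_algebra \<A> L"
  shows "congruence_preserving \<A> f"
  unfolding congruence_preserving_def compatible_unary_iff
proof (intro allI impI)
  fix r x y
  assume r: "congruence \<A> r" and xy: "(x, y) \<in> r"
  have "c_residually_finite_rel \<A> r"
    using resid r by (simp add: c_residually_finite_def)
  then obtain F where F: "\<forall>s\<in>F. congruence \<A> s \<and> finite_index (carrier \<A>) s"
    and r_eq: "r = carrier \<A> \<times> carrier \<A> \<inter> \<Inter>F"
    unfolding c_residually_finite_rel_def by (elim exE conjE)
  have "(f x, f y) \<in> s" if "s \<in> F" for s
  proof (rule mono_if_vimage_Image_upset[OF _ f])
    have cong: "congruence \<A> s" and fin: "finite_index (carrier \<A>) s"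
      using F that by auto
    then show s: "stable_preorder \<A> s"
      by (simp add: congruence_iff_sym_stable_preorder)
    show "(x, y) \<in> s"
      using xy r_eq that by auto
    have "s \<inter> s\<inverse> = s"
      using cong by (auto simp: congruence_iff_sym_stable_preorder dest: symD)
    then have "finite_index_preorder (carrier \<A>) s"
      using fin by (simp add: finite_index_preorder_def)
    then show "f -` (s `` {f x}) \<inter> carrier \<A> \<in> upsets (carrier \<A>) s"
      using vimage[OF recognizable_Image[OF alg s]]
        generated_boolean_algebra_subset_upsets[OF cong] by blast
  qed
  then show "(f x, f y) \<in> r"
    using f xy by (auto simp: r_eq)
qed

section \<open>Preservation and recognizable sets\<close>

theorem theorem3p11:
  fixes \<A> :: "('a, 'o) algebra" and f :: "'a \<Rightarrow> 'a"
  assumes "is_algebra \<A>" and "f \<in> carrier \<A> \<rightarrow> carrier \<A>"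
  shows "(sp_residually_finite \<A> \<longrightarrow>
            (stable_preorder_preserving \<A> f \<longleftrightarrow>
              (\<forall>L. recognizable \<A> L \<longrightarrow> f -` L \<inter> carrier \<A> \<in> generated_lattice \<A> L))) \<and>
         (c_residually_finite \<A> \<longrightarrow>
            (congruence_preserving \<A> f \<longleftrightarrow>
              (\<forall>L. recognizable \<A> L \<longrightarrow> f -` L \<inter> carrier \<A> \<in> generated_boolean_algebra \<A> L)))"
proof (intro conjI impI iffI allI)
  fix L
  assume "stable_preorder_preserving \<A> f" "recognizable \<A> L"
  with assms(1) show "f -` L \<inter> carrier \<A> \<in> generated_lattice \<A> L"
    by (rule vimage_in_generated_lattice)
next
  assume "sp_residually_finite \<A>"
    and "\<forall>L. recognizable \<A> L \<longrightarrow> f -` L \<inter> carrier \<A> \<in> generated_lattice \<A> L"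
  with assms show "stable_preorder_preserving \<A> f"
    by (intro stable_preorder_preservingI) simp_all
next
  fix L
  assume "congruence_preserving \<A> f" "recognizable \<A> L"
  with assms(1) show "f -` L \<inter> carrier \<A> \<in> generated_boolean_algebra \<A> L"
    by (rule vimage_in_generated_boolean_algebra)
next
  assume "c_residually_finite \<A>"
    and "\<forall>L. recognizable \<A> L \<longrightarrow> f -` L \<inter> carrier \<A> \<in> generated_boolean_algebra \<A> L"
  with assms show "congruence_preserving \<A> f"
    by (intro congruence_preservingI) simp_all
qed

end
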